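(* Let $P=(p_1,p_2,\ldots)$ be a sequence of prime numbers such that each prime number from $\mathbb{N}$ occurs infinitely often in $P$. Then, for each integer $k\ge 2$, the identity $e$ of the $P$-adic solenoid $\Sigma_P$ is the only periodic point of the limit mapping $h^k_P:\Sigma_P\to\Sigma_P$.
   Context: $\mathbb{N}$ is the set of positive integers; $1$ is not a prime. $\mathbb{S}^1$ is the unit circle in $\mathbb{C}$. For a sequence $P=(p_1,p_2,\ldots)$ of prime numbers, the $P$-adic solenoid is the inverse limit $\Sigma_P=\{(z_1,z_2,\ldots)\in\prod_{n\ge 1}\mathbb{S}^1 : z_{n+1}^{p_n}=z_n \text{ for all } n\in\mathbb{N}\}$ with the topology induced from the product topology; it is a compact abelian group under coordinatewise multiplication with identity $e=(1,1,\ldots)$. For $k\in\mathbb{N}$ the limit mapping $h^k_P:\Sigma_P\to\Sigma_P$ is $h^k_P((z_1,z_2,\ldots))=(z_1^k,z_2^k,\ldots)$. A prime $p$ occurs infinitely often in $P$ if $p=p_n$ for infinitely many indices $n$. A point $x\in X$ is periodic for a mapping $f:X\to X$ if there exists $n\in\mathbb{N}$ with $f^n(x)=x$, where $f^n$ is the $n$-th iterate of $f$. *)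

theory Defs
  imports "HOL-Analysis.Analysis" "HOL-Computational_Algebra.Primes"
begin

(* Sequences are indexed from 0: P n and z n stand for p_(n+1) and z_(n+1).
   The type nat => complex carries the product topology, so the solenoid, as a subspace of it,
   has the topology induced from the product of the circles. *)

definition solenoid :: "(nat \<Rightarrow> nat) \<Rightarrow> (nat \<Rightarrow> complex) set" where
  "solenoid P = {z. (\<forall>n. z n \<in> sphere 0 1) \<and> (\<forall>n. z (Suc n) ^ P n = z n)}"

definition solenoid_one :: "nat \<Rightarrow> complex" where
  "solenoid_one = (\<lambda>n. 1)"

(* The formula does not depend on P; limit_map_in_solenoid shows that it restricts
   to a self-map of every solenoid. *)
definition limit_map :: "nat \<Rightarrow> (nat \<Rightarrow> complex) \<Rightarrow> (nat \<Rightarrow> complex)" where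
  "limit_map k z = (\<lambda>n. z n ^ k)"

(* Intended for maps f that send X into X. *)
definition periodic_point :: "'a set \<Rightarrow> ('a \<Rightarrow> 'a) \<Rightarrow> 'a \<Rightarrow> bool" where
  "periodic_point X f x \<longleftrightarrow> x \<in> X \<and> (\<exists>n\<ge>1. (f ^^ n) x = x)"

lemma solenoid_one_in_solenoid: "solenoid_one \<in> solenoid P"
  by (simp add: solenoid_def solenoid_one_def)

lemma solenoid_mult_closed:
  "z \<in> solenoid P \<Longrightarrow> w \<in> solenoid P \<Longrightarrow> (\<lambda>n. z n * w n) \<in> solenoid P"
  by (simp add: solenoid_def norm_mult power_mult_distrib)

lemma solenoid_inverse_closed:
  "z \<in> solenoid P \<Longrightarrow> (\<lambda>n. inverse (z n)) \<in> solenoid P"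
  by (simp add: solenoid_def norm_inverse power_inverse)

lemma solenoid_one_mult: "(\<lambda>n. solenoid_one n * z n) = z"
  by (simp add: solenoid_one_def)

lemma limit_map_in_solenoid: "limit_map k \<in> solenoid P \<rightarrow> solenoid P"
  by (auto simp: solenoid_def limit_map_def norm_power simp flip: power_mult)
     (metis mult.commute power_mult)

lemma continuous_on_limit_map: "continuous_on (solenoid P) (limit_map k)"
  unfolding limit_map_def
  by (intro continuous_on_coordinatewise_then_product continuous_intros
        continuous_on_subset[OF continuous_on_product_coordinates]) auto

end

theory Submission
  imports Defs
begin

text \<open>A point \<open>z\<close> with \<open>(h\<^sup>m) z = z\<close> satisfies \<open>z n ^ (k ^ m - 1) = 1\<close> for all \<open>n\<close>, so it suffices
  that the solenoid is torsion free. If all coordinates are killed by \<open>p * e\<close> with \<open>p\<close> prime, then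
  a coordinate \<open>z m\<close> with \<open>P m = p\<close> is the \<open>p\<close>-th power of the next one and is killed by \<open>e\<close>. Such
  \<open>m\<close> are arbitrarily large and every coordinate is a power of each later one, so \<open>e\<close>
  kills all coordinates; hence the exponent descends to 1.\<close>

lemma limit_map_funpow: "(limit_map k ^^ m) z = (\<lambda>n. z n ^ (k ^ m))"
  by (induction m) (simp_all add: limit_map_def fun_eq_iff power_mult [symmetric] mult.commute)

lemma solenoid_coordinate_eq_power_later:
  assumes "z \<in> solenoid P" and "n \<le> m"
  shows "\<exists>q. z n = z m ^ q"
  using assms(2)
proof (induction m rule: dec_induct)
  case base
  show ?case by (rule exI [of _ 1]) simp
next
  case (step m)
  then obtain q where "z n = z m ^ q" by blast
  moreover have "z m = z (Suc m) ^ P m"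
    using assms(1) by (simp add: solenoid_def)
  ultimately show ?case by (metis power_mult)
qed

lemma solenoid_torsion_free:
  assumes inf: "\<forall>p. prime p \<longrightarrow> infinite {n. P n = p}"
    and z: "z \<in> solenoid P"
    and "d \<ge> 1" and "\<forall>n. z n ^ d = 1"
  shows "z = solenoid_one"
  using assms(3,4)
proof (induction d rule: less_induct)
  case (less d)
  show ?case
  proof (cases "d = 1")
    case True
    then show ?thesis
      using less.prems by (simp add: solenoid_one_def fun_eq_iff)
  next
    case False
    then obtain p where p: "prime p" "p dvd d"
      using prime_factor_nat by blast
    then obtain e where e: "d = p * e" by blast
    have "z n ^ e = 1" for n
    proof -
      obtain m where m: "m \<ge> n" "P m = p"
        using inf p(1) by (auto simp: infinite_nat_iff_unbounded_le)
      have "z m = z (Suc m) ^ p"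
        using z unfolding solenoid_def m(2) [symmetric] by simp
      then have "z m ^ e = 1"
        using less.prems(2) e by (simp add: power_mult [symmetric])
      moreover obtain q where "z n = z m ^ q"
        using solenoid_coordinate_eq_power_later [OF z m(1)] by blast
      \<comment> \<open>\<open>(z m ^ q) ^ e\<close> is rearranged to \<open>z m ^ (e * q)\<close>
        and then split as \<open>(z m ^ e) ^ q\<close>, which is 1.\<close>
      ultimately show ?thesis
        by (simp add: power_mult [symmetric] mult.commute [of q]) (simp add: power_mult)
    qed
    \<comment> \<open>Exponent 0 kills every point, so the descent has to keep the exponent
      positive.\<close>
    moreover have "e \<ge> 1"
      using e less.prems(1) by (cases "e = 0") auto
    moreover from this have "e < d"
      unfolding e using prime_gt_1_nat [OF p(1)] by simp
    ultimately show ?thesis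
      using less.IH by blast
  qed
qed

theorem proposition5:
  fixes P :: "nat \<Rightarrow> nat" and k :: nat
  assumes "\<forall>n. prime (P n)"
    and "\<forall>p. prime p \<longrightarrow> infinite {n. P n = p}"
    and "k \<ge> 2"
  shows "{x. periodic_point (solenoid P) (limit_map k) x} = {solenoid_one}"
proof (intro equalityI subsetI)
  fix z assume "z \<in> {x. periodic_point (solenoid P) (limit_map k) x}"
  then obtain m where z: "z \<in> solenoid P" and m: "m \<ge> 1" "(limit_map k ^^ m) z = z"
    by (auto simp: periodic_point_def)
  \<comment> \<open>For \<open>k = 1\<close> the exponent \<open>k ^ m - 1\<close> would be 0 and
    \<open>z n ^ 0 = 1\<close> would say nothing about \<open>z\<close>.\<close>
  have "k ^ m > 1"
    using assms(3) m(1) by (intro one_less_power) auto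
  then have d: "k ^ m - 1 \<ge> 1"
    by linarith
  have "z n ^ (k ^ m - 1) = 1" for n
  proof -
    have "z n ^ (k ^ m) = z n"
      using m(2) by (simp add: limit_map_funpow fun_eq_iff)
    then have "z n ^ (k ^ m - 1) * z n = z n"
      using power_minus_mult [OF less_trans [OF zero_less_one \<open>k ^ m > 1\<close>], of "z n"]
      by (rule trans [rotated])
    \<comment> \<open>Points of the unit circle are nonzero, so the factor \<open>z n\<close>
      cancels.\<close>
    moreover have "norm (z n) = 1"
      using z by (simp add: solenoid_def)
    then have "z n \<noteq> 0"
      by auto
    ultimately show ?thesis by simp
  qed
  then show "z \<in> {solenoid_one}"
    using solenoid_torsion_free [OF assms(2) z d] by blast
next
  fix z assume "z \<in> {solenoid_one}"
  moreover have "(limit_map k ^^ 1) solenoid_one = solenoid_one"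
    by (simp add: limit_map_def solenoid_one_def)
  ultimately show "z \<in> {x. periodic_point (solenoid P) (limit_map k) x}"
    using solenoid_one_in_solenoid by (auto simp: periodic_point_def)
qed

end
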